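(* Let $k$ be a positive integer. For every row-convex $\{0,1\}$-matrix $M$ with no identically zero column there is a doubly convex $\{0,1\}$-matrix $M'$ such that $\mathcal B_{M,\mathbf b}=\mathcal B_{M',\mathbf b'}$, where $\mathbf b=(k,k,\dots,k)$ and $\mathbf b'=(k,k,\dots,k)$ are constant vectors with as many entries as $M$ and $M'$ have rows, respectively.
   Context: A $\{0,1\}$-matrix is column convex if the nonzero entries in every column are contiguous, row convex if the nonzero entries in every row are contiguous, and doubly convex if it is both. For an $n\times d$ matrix $M$ and $\mathbf b\in\mathbb Z^n$, $\mathcal B_{M,\mathbf b}=\{\mathbf z\in\mathbb R^d_{\ge0}: M\mathbf z\le\mathbf b\}$ (entrywise). *)

theory Defs
  imports Complex_Main "Jordan_Normal_Form.Matrix"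
begin

definition zero_one_mat :: "real mat \<Rightarrow> bool" where
  "zero_one_mat M \<longleftrightarrow> elements_mat M \<subseteq> {0, 1}"

text \<open>A set of positions is contiguous if it has no gaps; the empty set counts as contiguous.\<close>
definition contiguous :: "nat set \<Rightarrow> bool" where
  "contiguous S \<longleftrightarrow> (\<forall>a\<in>S. \<forall>c\<in>S. \<forall>b. a \<le> b \<and> b \<le> c \<longrightarrow> b \<in> S)"

definition row_convex :: "real mat \<Rightarrow> bool" where
  "row_convex M \<longleftrightarrow> (\<forall>i < dim_row M. contiguous {j. j < dim_col M \<and> M $$ (i, j) \<noteq> 0})"

definition column_convex :: "real mat \<Rightarrow> bool" where
  "column_convex M \<longleftrightarrow> (\<forall>j < dim_col M. contiguous {i. i < dim_row M \<and> M $$ (i, j) \<noteq> 0})"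

definition doubly_convex :: "real mat \<Rightarrow> bool" where
  "doubly_convex M \<longleftrightarrow> row_convex M \<and> column_convex M"

definition no_zero_column :: "real mat \<Rightarrow> bool" where
  "no_zero_column M \<longleftrightarrow> (\<forall>j < dim_col M. col M j \<noteq> 0\<^sub>v (dim_row M))"

text \<open>The order on vectors is the entrywise one and requires equal dimensions, so
  the dimension of \<open>b\<close> is meant to be the number of rows of \<open>M\<close>.\<close>
definition polytope_B :: "real mat \<Rightarrow> int vec \<Rightarrow> real vec set" where
  "polytope_B M b =
     {z \<in> carrier_vec (dim_col M).
        0\<^sub>v (dim_col M) \<le> z \<and> M *\<^sub>v z \<le> map_vec real_of_int b}"

definition const_vec :: "nat \<Rightarrow> int \<Rightarrow> int vec" where
  "const_vec n k = vec n (\<lambda>_. k)"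

end

theory Submission
  imports Defs
begin

text \<open>
  For \<open>z \<ge> 0\<close> a row constraint follows from that of any entrywise larger row, so only the maximal
  intervals among the rows matter. Row \<open>j\<close> of the new matrix is the longest interval
  starting at \<open>j\<close> that is contained in some row of \<open>M\<close>. It is contained in a row of
  \<open>M\<close> by definition, and every nonzero row of \<open>M\<close> is contained in the new row indexed by its first
  nonzero column.
\<close>

lemma polytope_B_const_vec_iff:
  assumes "M \<in> carrier_mat n d"
  shows "z \<in> polytope_B M (const_vec n k) \<longleftrightarrow>
    z \<in> carrier_vec d \<and> (\<forall>j<d. 0 \<le> z $ j) \<and>
    (\<forall>i<n. (\<Sum>j<d. M $$ (i, j) * z $ j) \<le> of_int k)"
proof -
  have dims: "dim_row M = n" "dim_col M = d" using assms by auto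
  show ?thesis
  proof (cases "z \<in> carrier_vec d")
    case True
    then have "dim_vec z = d" by simp
    then have "(M *\<^sub>v z) $ i = (\<Sum>j<d. M $$ (i, j) * z $ j)" if "i < n" for i
      using dims that by (simp add: scalar_prod_def atLeast0LessThan)
    moreover have "0\<^sub>v d \<le> z \<longleftrightarrow> (\<forall>j<d. 0 \<le> z $ j)"
      using \<open>dim_vec z = d\<close> by (simp add: less_eq_vec_def)
    moreover have "M *\<^sub>v z \<le> map_vec real_of_int (const_vec n k) \<longleftrightarrow>
        (\<forall>i<n. (M *\<^sub>v z) $ i \<le> of_int k)"
      by (simp add: less_eq_vec_def const_vec_def dims del: index_mult_mat_vec)
    ultimately show ?thesis
      using True unfolding polytope_B_def dims by simp
  qed (simp add: polytope_B_def dims)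
qed

lemma zero_one_matD:
  assumes "zero_one_mat M" "i < dim_row M" "j < dim_col M"
  shows "M $$ (i, j) = 0 \<or> M $$ (i, j) = 1"
proof -
  have "M $$ (i, j) \<in> elements_mat M" using assms(2,3) by auto
  then show ?thesis using assms(1) by (auto simp: zero_one_mat_def)
qed

text \<open>A zero row of \<open>M\<close> forms its own alternative: its constraint is only
  \<open>0 \<le> k\<close>, it has no first nonzero column by which to choose a dominating row, and
  \<open>N\<close> may have no rows at all.\<close>

lemma polytope_B_subset_if_rows_dominated:
  assumes M: "M \<in> carrier_mat n d" and N: "N \<in> carrier_mat m d" and "0 \<le> k"
    and dom: "\<And>i. i < n \<Longrightarrow>
      (\<forall>j<d. M $$ (i, j) = 0) \<or> (\<exists>i'<m. \<forall>j<d. M $$ (i, j) \<le> N $$ (i', j))"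
  shows "polytope_B N (const_vec m k) \<subseteq> polytope_B M (const_vec n k)"
proof
  fix z assume "z \<in> polytope_B N (const_vec m k)"
  then have z: "z \<in> carrier_vec d" and pos: "\<And>j. j < d \<Longrightarrow> 0 \<le> z $ j"
    and le: "\<And>i. i < m \<Longrightarrow> (\<Sum>j<d. N $$ (i, j) * z $ j) \<le> of_int k"
    by (auto simp: polytope_B_const_vec_iff[OF N])
  have "(\<Sum>j<d. M $$ (i, j) * z $ j) \<le> of_int k" if "i < n" for i
    using dom[OF that]
  proof
    assume "\<forall>j<d. M $$ (i, j) = 0"
    then show ?thesis using \<open>0 \<le> k\<close> by simp
  next
    assume "\<exists>i'<m. \<forall>j<d. M $$ (i, j) \<le> N $$ (i', j)"
    then obtain i' where i': "i' < m" "\<And>j. j < d \<Longrightarrow> M $$ (i, j) \<le> N $$ (i', j)"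
      by blast
    have "(\<Sum>j<d. M $$ (i, j) * z $ j) \<le> (\<Sum>j<d. N $$ (i', j) * z $ j)"
      by (intro sum_mono mult_right_mono) (auto simp: i' pos)
    also have "\<dots> \<le> of_int k" using le i' by blast
    finally show ?thesis .
  qed
  with z pos show "z \<in> polytope_B M (const_vec n k)"
    by (simp add: polytope_B_const_vec_iff[OF M])
qed

text \<open>For row-convex \<open>M\<close>, entry \<open>(j, c)\<close> tells whether the interval
  from \<open>j\<close> to \<open>c\<close> lies in the support of a single row: testing
  \<open>c\<close> and some \<open>a \<le> j\<close> suffices, since convexity fills the gap. As
  \<open>a\<close> may be any column up to \<open>j\<close>, a witness for \<open>j\<close> remains
  one for every larger row index up to \<open>c\<close>, which gives column convexity.\<close>

definition interval_mat :: "real mat \<Rightarrow> real mat" where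
  "interval_mat M = mat (dim_col M) (dim_col M) (\<lambda>(j, c). of_bool
     (j \<le> c \<and> (\<exists>i<dim_row M. \<exists>a\<le>j. M $$ (i, a) \<noteq> 0 \<and> M $$ (i, c) \<noteq> 0)))"

lemma interval_mat_carrier: "interval_mat M \<in> carrier_mat (dim_col M) (dim_col M)"
  by (simp add: interval_mat_def)

lemma zero_one_interval_mat: "zero_one_mat (interval_mat M)"
  by (auto simp: zero_one_mat_def interval_mat_def elements_mat_def)

lemma row_convexD:
  assumes "row_convex M" "i < dim_row M" "M $$ (i, a) \<noteq> 0" "M $$ (i, c) \<noteq> 0"
    and "a \<le> b" "b \<le> c" "c < dim_col M"
  shows "M $$ (i, b) \<noteq> 0"
proof -
  let ?S = "{j. j < dim_col M \<and> M $$ (i, j) \<noteq> 0}"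
  have "contiguous ?S" using assms(1,2) by (simp add: row_convex_def)
  moreover have "a \<in> ?S" "c \<in> ?S" using assms by auto
  ultimately have "b \<in> ?S" using assms(5,6) unfolding contiguous_def by blast
  then show ?thesis by simp
qed

lemma interval_mat_nonzero_iff:
  assumes "j < dim_col M" "c < dim_col M"
  shows "interval_mat M $$ (j, c) \<noteq> 0 \<longleftrightarrow>
    j \<le> c \<and> (\<exists>i<dim_row M. \<exists>a\<le>j. M $$ (i, a) \<noteq> 0 \<and> M $$ (i, c) \<noteq> 0)"
  using assms by (simp add: interval_mat_def)

lemma row_convex_interval_mat:
  assumes "row_convex M"
  shows "row_convex (interval_mat M)"
  unfolding row_convex_def contiguous_def
proof (intro allI impI ballI)
  fix j c e b
  assume "j < dim_row (interval_mat M)"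
    and "c \<in> {c. c < dim_col (interval_mat M) \<and> interval_mat M $$ (j, c) \<noteq> 0}"
    and "e \<in> {c. c < dim_col (interval_mat M) \<and> interval_mat M $$ (j, c) \<noteq> 0}"
    and b: "c \<le> b \<and> b \<le> e"
  then have j: "j < dim_col M" and e: "e < dim_col M"
    and nz: "interval_mat M $$ (j, c) \<noteq> 0" "interval_mat M $$ (j, e) \<noteq> 0"
    using interval_mat_carrier[of M] by auto
  from nz(1) have "j \<le> c" using j e b by (simp add: interval_mat_nonzero_iff)
  \<comment> \<open>The row of \<open>M\<close> that witnesses the right end \<open>e\<close> covers
    everything from \<open>a \<le> j\<close> to \<open>e\<close>, hence also \<open>b\<close>; the
    left end \<open>c\<close> only contributes \<open>j \<le> c \<le> b\<close>.\<close>
  from nz(2) obtain i a where i: "i < dim_row M" "a \<le> j" "M $$ (i, a) \<noteq> 0" "M $$ (i, e) \<noteq> 0"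
    using j e by (auto simp: interval_mat_nonzero_iff)
  have "M $$ (i, b) \<noteq> 0"
    by (rule row_convexD[OF assms i(1,3,4)]) (use i \<open>j \<le> c\<close> b e in auto)
  moreover have "j \<le> b" "b < dim_col M" using \<open>j \<le> c\<close> b e by auto
  ultimately have "interval_mat M $$ (j, b) \<noteq> 0"
    using interval_mat_nonzero_iff[of j M b] i(1-3) j by blast
  then show "b \<in> {c. c < dim_col (interval_mat M) \<and> interval_mat M $$ (j, c) \<noteq> 0}"
    using b e interval_mat_carrier[of M] by auto
qed

lemma column_convex_interval_mat: "column_convex (interval_mat M)"
  unfolding column_convex_def contiguous_def
proof (intro allI impI ballI)
  fix c j l b
  assume "c < dim_col (interval_mat M)"
    and "j \<in> {j. j < dim_row (interval_mat M) \<and> interval_mat M $$ (j, c) \<noteq> 0}"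
    and "l \<in> {j. j < dim_row (interval_mat M) \<and> interval_mat M $$ (j, c) \<noteq> 0}"
    and b: "j \<le> b \<and> b \<le> l"
  then have c: "c < dim_col M" and l: "l < dim_col M"
    and nz: "interval_mat M $$ (j, c) \<noteq> 0" "interval_mat M $$ (l, c) \<noteq> 0"
    using interval_mat_carrier[of M] by auto
  \<comment> \<open>The two ends have different roles: the larger index \<open>l\<close> yields
    \<open>b \<le> l \<le> c\<close>, while the smaller index \<open>j\<close> supplies the row
    \<open>i\<close> and the column \<open>a \<le> j \<le> b\<close> that serve for \<open>b\<close>
    as well.\<close>
  from nz(2) have "l \<le> c" using c l by (simp add: interval_mat_nonzero_iff)
  from nz(1) obtain i a where i: "i < dim_row M" "a \<le> j" "M $$ (i, a) \<noteq> 0" "M $$ (i, c) \<noteq> 0"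
    using c l b by (auto simp: interval_mat_nonzero_iff)
  have "a \<le> b" "b \<le> c" "b < dim_col M" using i(2) b l \<open>l \<le> c\<close> by auto
  then have "interval_mat M $$ (b, c) \<noteq> 0"
    using interval_mat_nonzero_iff[of b M c] i(1,3,4) c by blast
  then show "b \<in> {j. j < dim_row (interval_mat M) \<and> interval_mat M $$ (j, c) \<noteq> 0}"
    using b l interval_mat_carrier[of M] by auto
qed

lemma row_dominated_by_interval_mat:
  assumes "zero_one_mat M" and "i < dim_row M"
  shows "(\<forall>j<dim_col M. M $$ (i, j) = 0) \<or>
    (\<exists>a<dim_col M. \<forall>j<dim_col M. M $$ (i, j) \<le> interval_mat M $$ (a, j))"
proof (cases "\<forall>j<dim_col M. M $$ (i, j) = 0")
  case False
  define a where "a = (LEAST a. a < dim_col M \<and> M $$ (i, a) \<noteq> 0)"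
  have a: "a < dim_col M" "M $$ (i, a) \<noteq> 0"
    using False LeastI_ex[of "\<lambda>a. a < dim_col M \<and> M $$ (i, a) \<noteq> 0"] by (auto simp: a_def)
  have "M $$ (i, j) \<le> interval_mat M $$ (a, j)" if "j < dim_col M" for j
  proof (cases "M $$ (i, j) = 0")
    case True
    \<comment> \<open>Here only nonnegativity of the entries of \<open>interval_mat M\<close>
      matters.\<close>
    then show ?thesis using a that by (simp add: interval_mat_def)
  next
    case False
    then have "M $$ (i, j) = 1"
      using zero_one_matD[OF assms that] by simp
    moreover have "a \<le> j"
      unfolding a_def using False that by (intro Least_le) simp
    \<comment> \<open>Row \<open>i\<close> is its own witness, with \<open>b = a\<close>.\<close>
    then have "a \<le> j \<and> (\<exists>i<dim_row M. \<exists>b\<le>a. M $$ (i, b) \<noteq> 0 \<and> M $$ (i, j) \<noteq> 0)"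
      using a(2) False assms(2) by blast
    ultimately show ?thesis
      using a(1) that by (simp add: interval_mat_def)
  qed
  with a show ?thesis by blast
qed simp

text \<open>The entries of row \<open>j\<close> could come from different rows of \<open>M\<close>,
  but one row covers them all: the one that witnesses the last nonzero column. It is nonzero at some
  \<open>a \<le> j\<close> and at that column, so by convexity on everything between, and row
  \<open>j\<close> vanishes left of \<open>j\<close>.\<close>

lemma interval_mat_row_dominated:
  assumes "zero_one_mat M" and "row_convex M" and j: "j < dim_col M"
  shows "(\<forall>c<dim_col M. interval_mat M $$ (j, c) = 0) \<or>
    (\<exists>i<dim_row M. \<forall>c<dim_col M. interval_mat M $$ (j, c) \<le> M $$ (i, c))"
proof (cases "\<forall>c<dim_col M. interval_mat M $$ (j, c) = 0")
  case False
  define S where "S = {c. c < dim_col M \<and> interval_mat M $$ (j, c) \<noteq> 0}"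
  have "finite S" "S \<noteq> {}" using False by (auto simp: S_def)
  then have Max: "Max S \<in> S" "\<And>c. c \<in> S \<Longrightarrow> c \<le> Max S" by auto
  then obtain i a where i: "i < dim_row M" "a \<le> j" "M $$ (i, a) \<noteq> 0" "M $$ (i, Max S) \<noteq> 0"
    using j by (auto simp: S_def interval_mat_def)
  have "interval_mat M $$ (j, c) \<le> M $$ (i, c)" if c: "c < dim_col M" for c
  proof -
    have 01: "M $$ (i, c) = 0 \<or> M $$ (i, c) = 1"
      by (rule zero_one_matD[OF assms(1) i(1) c])
    show ?thesis
    proof (cases "c \<in> S")
      case True
      then have "j \<le> c" using j by (auto simp: S_def interval_mat_def)
      then have "M $$ (i, c) \<noteq> 0"
        using row_convexD[OF assms(2) i(1,3,4)] i(2) Max True by (auto simp: S_def)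
      \<comment> \<open>Every entry of \<open>interval_mat M\<close> is at most 1, so a nonzero
        entry of \<open>M\<close>, being 1, dominates it.\<close>
      then show ?thesis using 01 j c by (auto simp: interval_mat_def)
    next
      case False
      then show ?thesis using 01 c by (auto simp: S_def)
    qed
  qed
  with i show ?thesis by blast
qed simp

theorem lemma5p2:
  fixes k :: int and n d :: nat and M :: "real mat"
  assumes "k > 0"
    and "M \<in> carrier_mat n d"
    and "zero_one_mat M"
    and "row_convex M"
    and "no_zero_column M"
  shows "\<exists>n' M'. M' \<in> carrier_mat n' d \<and> zero_one_mat M' \<and> doubly_convex M' \<and>
           polytope_B M (const_vec n k) = polytope_B M' (const_vec n' k)"
proof (intro exI conjI)
  have dims: "dim_row M = n" "dim_col M = d" using assms(2) by auto
  show carrier: "interval_mat M \<in> carrier_mat d d"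
    using interval_mat_carrier[of M] by (simp add: dims)
  show "zero_one_mat (interval_mat M)" by (rule zero_one_interval_mat)
  show "doubly_convex (interval_mat M)"
    using assms(4) by (simp add: doubly_convex_def row_convex_interval_mat column_convex_interval_mat)
  show "polytope_B M (const_vec n k) = polytope_B (interval_mat M) (const_vec d k)"
  proof
    \<comment> \<open>In each inclusion the rows of the matrix on the right are dominated by rows of
      the matrix on the left.\<close>
    show "polytope_B M (const_vec n k) \<subseteq> polytope_B (interval_mat M) (const_vec d k)"
      using polytope_B_subset_if_rows_dominated[OF carrier assms(2)]
        interval_mat_row_dominated[OF assms(3,4)] assms(1) by (simp add: dims)
    show "polytope_B (interval_mat M) (const_vec d k) \<subseteq> polytope_B M (const_vec n k)"
      using polytope_B_subset_if_rows_dominated[OF assms(2) carrier]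
        row_dominated_by_interval_mat[OF assms(3)] assms(1) by (simp add: dims)
  qed
qed

end
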